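(* Let $N_s\ge 1$ satellites be distributed independently and uniformly on a sphere of radius $R_s$ centered at the Earth's center $O$, and let the receiver be a fixed point at distance $R_e$ from $O$, with $0<R_e<R_s$. Let $d_{\mathrm{down}}$ be the Euclidean distance between the receiver and the relay satellite, where the relay satellite is the satellite nearest to the receiver. Then the cumulative distribution function of $d_{\mathrm{down}}$ is $$F_{d_{\mathrm{down}}}(d_0)=\begin{cases}0, & d_0\le R_s-R_e,\\[2mm] 1-\left(1-\dfrac{d_0^2-(R_s-R_e)^2}{4R_eR_s}\right)^{N_s}, & R_s-R_e<d_0<R_s+R_e,\\[2mm] 1, & d_0\ge R_s+R_e.\end{cases}$$
   Context: The satellites form a homogeneous binomial point process on the sphere of radius $R_s$, i.e. they are $N_s$ independent points, each uniformly distributed with respect to surface area. The relay (serving) satellite is the one, among all $N_s$ satellites, that is nearest to the receiver. *)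

theory Defs
  imports "HOL-Probability.Probability" "HOL-Analysis.Cross3"
begin

text \<open>Area measure of a parametrized surface in three-space: the image under the parametrization
  of the surface element \<open>\<bar>f\<^sub>u \<times> f\<^sub>v\<bar> du dv\<close>. The parametrization should be Borel measurable,
  injective on the domain up to a null set, and have a Borel measurable surface element.\<close>

definition surface_element :: "(real \<times> real \<Rightarrow> real^3) \<Rightarrow> real \<times> real \<Rightarrow> real" where
  "surface_element f = (\<lambda>(u, v).
     norm (cross3 (vector_derivative (\<lambda>s. f (s, v)) (at u))
                  (vector_derivative (\<lambda>t. f (u, t)) (at v))))"

definition surface_area_measure ::
    "(real \<times> real \<Rightarrow> real^3) \<Rightarrow> (real \<times> real) set \<Rightarrow> (real^3) measure" where
  "surface_area_measure f D =
     distr (density lborel (\<lambda>q. ennreal (surface_element f q) * indicator D q)) borel f"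

text \<open>Colatitude and longitude; on the domain \<open>[0, \<pi>] \<times> [0, 2\<pi>)\<close> this covers the sphere of
  radius \<open>R\<close> about \<open>c\<close>, and only the two poles are attained more than once.\<close>

definition spherical_coords :: "real^3 \<Rightarrow> real \<Rightarrow> real \<times> real \<Rightarrow> real^3" where
  "spherical_coords c R = (\<lambda>(\<theta>, \<phi>).
     c + R *\<^sub>R vector [sin \<theta> * cos \<phi>, sin \<theta> * sin \<phi>, cos \<theta>])"

definition sphere_area_measure :: "real^3 \<Rightarrow> real \<Rightarrow> (real^3) measure" where
  "sphere_area_measure c R =
     surface_area_measure (spherical_coords c R) ({0..pi} \<times> {0..<2 * pi})"

definition uniform_on_sphere :: "real^3 \<Rightarrow> real \<Rightarrow> (real^3) measure" where
  "uniform_on_sphere c R = uniform_measure (sphere_area_measure c R) (sphere c R)"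

end

theory Submission
  imports Defs
begin

text \<open>The relay lies within distance \<open>d\<close> of the receiver unless all satellites miss the closed
  ball of radius \<open>d\<close> about it. By independence the latter has probability \<open>(1 - F)\<^sup>N\<close>, where \<open>F\<close> is
  the probability that one uniform point of the sphere lies in the ball. The ball meets the sphere
  in a spherical cap, and the area of a cap is proportional to its height (Archimedes), which gives
  \<open>F = (d\<^sup>2 - (R\<^sub>s - R\<^sub>e)\<^sup>2) / (4 R\<^sub>e R\<^sub>s)\<close>.

  The area measure is given in spherical coordinates, with area element \<open>R\<^sup>2 sin \<theta>\<close>. For a cap about
  a pole of these coordinates Archimedes' theorem is the integral of \<open>sin \<theta>\<close>. The receiver may lie in
  any direction, so rotational invariance is needed: for a unit vector \<open>e\<close>, the coordinate \<open>e \<bullet> n\<close>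
  of a uniform unit vector \<open>n\<close> has the law of the height \<open>cos \<theta>\<close>
  (\<open>distr_inner_angle_measure\<close>). By uniqueness of characteristic functions it suffices to compare the
  integrals of \<open>f(e \<bullet> n)\<close> for smooth \<open>f\<close>. Moving \<open>e\<close> towards the pole along a meridian changes such
  an integral at a rate that is the integral of a divergence, hence zero
  (\<open>integral_zonal_function_rotate\<close>).\<close>

section \<open>The sphere in spherical coordinates\<close>

text \<open>In this form the rules for derivatives and continuity apply to the chart.\<close>

lemma spherical_coords_axis:
  "spherical_coords c R (\<theta>, \<phi>) = c + R *\<^sub>R (
     (sin \<theta> * cos \<phi>) *\<^sub>R axis 1 1 + (sin \<theta> * sin \<phi>) *\<^sub>R axis 2 1 + cos \<theta> *\<^sub>R axis 3 1)"
  by (simp add: spherical_coords_def vec_eq_iff forall_3 axis_def)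

lemma surface_element_spherical_coords:
  "surface_element (spherical_coords c R) (\<theta>, \<phi>) = R\<^sup>2 * \<bar>sin \<theta>\<bar>"
proof -
  let ?N = "\<lambda>a b d. R *\<^sub>R (a *\<^sub>R axis 1 1 + b *\<^sub>R axis 2 1 + d *\<^sub>R axis 3 1 :: real^3)"
  have "((\<lambda>s. spherical_coords c R (s, \<phi>)) has_vector_derivative
      ?N (cos \<theta> * cos \<phi>) (cos \<theta> * sin \<phi>) (- sin \<theta>)) (at \<theta>)"
    unfolding spherical_coords_axis by (auto intro!: derivative_eq_intros simp: algebra_simps)
  moreover have "((\<lambda>t. spherical_coords c R (\<theta>, t)) has_vector_derivative
      ?N (- sin \<theta> * sin \<phi>) (sin \<theta> * cos \<phi>) 0) (at \<phi>)"
    unfolding spherical_coords_axis by (auto intro!: derivative_eq_intros simp: algebra_simps)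
  ultimately have "surface_element (spherical_coords c R) (\<theta>, \<phi>) =
      norm (cross3 (?N (cos \<theta> * cos \<phi>) (cos \<theta> * sin \<phi>) (- sin \<theta>))
                   (?N (- sin \<theta> * sin \<phi>) (sin \<theta> * cos \<phi>) 0))"
    by (simp add: surface_element_def vector_derivative_at)
  also have "\<dots> = sqrt ((R * sin \<theta> * (R * (sin \<theta> * cos \<phi>)))\<^sup>2 +
      (R * sin \<theta> * (R * (sin \<theta> * sin \<phi>)))\<^sup>2 +
      (R * (cos \<theta> * cos \<phi>) * (R * (sin \<theta> * cos \<phi>)) +
       R * (cos \<theta> * sin \<phi>) * (R * (sin \<theta> * sin \<phi>)))\<^sup>2)"
    unfolding norm_vec_def L2_set_def sum_3 by (simp add: cross3_def axis_def)
  \<comment> \<open>The factors \<open>sin\<^sup>2 \<phi> + cos\<^sup>2 \<phi>\<close> stay unevaluated so that both sides are the same polynomial.\<close>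
  also have "\<dots> = sqrt ((R\<^sup>2 * sin \<theta>)\<^sup>2 * ((sin \<theta>)\<^sup>2 * ((sin \<phi>)\<^sup>2 + (cos \<phi>)\<^sup>2)
      + (cos \<theta>)\<^sup>2 * ((sin \<phi>)\<^sup>2 + (cos \<phi>)\<^sup>2)\<^sup>2))"
    by (rule arg_cong[where f = sqrt]) algebra
  also have "\<dots> = R\<^sup>2 * \<bar>sin \<theta>\<bar>"
    by (simp add: abs_mult)
  finally show ?thesis .
qed

lemma inner_spherical_coords:
  "spherical_coords 0 1 (\<psi>, \<alpha>) \<bullet> spherical_coords 0 1 (\<theta>, \<phi>) =
     sin \<psi> * (sin \<theta> * cos (\<phi> - \<alpha>)) + cos \<psi> * cos \<theta>"
  by (simp add: spherical_coords_def inner_vec_def sum_3 cos_diff algebra_simps)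

lemma continuous_on_spherical_coords: "continuous_on S (spherical_coords c R)"
proof -
  have "spherical_coords c R = (\<lambda>q. c + R *\<^sub>R (
     (sin (fst q) * cos (snd q)) *\<^sub>R axis 1 1 + (sin (fst q) * sin (snd q)) *\<^sub>R axis 2 1 + cos (fst q) *\<^sub>R axis 3 1))"
    using spherical_coords_axis by auto
  then show ?thesis by (auto intro!: continuous_intros)
qed

lemma spherical_coords_measurable [measurable]: "spherical_coords c R \<in> borel_measurable borel"
  by (intro borel_measurable_continuous_onI continuous_on_spherical_coords)

lemma dist_spherical_coords: "dist c (spherical_coords c R q) = \<bar>R\<bar>"
proof -
  obtain \<theta> \<phi> where q: "q = (\<theta>, \<phi>)" by force
  have "(R * (sin \<theta> * cos \<phi>))\<^sup>2 + (R * (sin \<theta> * sin \<phi>))\<^sup>2 + (R * cos \<theta>)\<^sup>2 =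
    R\<^sup>2 * ((sin \<theta>)\<^sup>2 * ((sin \<phi>)\<^sup>2 + (cos \<phi>)\<^sup>2) + (cos \<theta>)\<^sup>2)" by algebra
  also have "\<dots> = R\<^sup>2" by simp
  finally show ?thesis
    unfolding q by (simp add: spherical_coords_def dist_norm norm_vec_def L2_set_def sum_3)
qed

lemma unit_vector_spherical:
  fixes e :: "real^3"
  assumes "norm e = 1"
  obtains \<psi> \<alpha> where "e = spherical_coords 0 1 (\<psi>, \<alpha>)"
proof -
  have n: "(e $ 1)\<^sup>2 + (e $ 2)\<^sup>2 + (e $ 3)\<^sup>2 = 1"
    using assms by (simp add: norm_vec_def L2_set_def sum_3)
  define \<psi> where "\<psi> = arccos (e $ 3)"
  have "(e $ 3)\<^sup>2 \<le> 1"
    using n by (smt (verit) zero_le_power2)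
  then have e3: "\<bar>e $ 3\<bar> \<le> 1"
    by (simp add: abs_square_le_1)
  then have c: "cos \<psi> = e $ 3"
    by (simp add: \<psi>_def)
  then have s: "(e $ 1)\<^sup>2 + (e $ 2)\<^sup>2 = (sin \<psi>)\<^sup>2"
    using n sin_squared_eq[of \<psi>] by simp
  obtain \<alpha> where "e $ 1 = sin \<psi> * cos \<alpha>" "e $ 2 = sin \<psi> * sin \<alpha>"
  proof (cases "sin \<psi> = 0")
    \<comment> \<open>At a pole every longitude serves.\<close>
    case True
    with s that[of 0] show ?thesis by (simp add: sum_power2_eq_zero_iff)
  next
    case False
    with s have "(e $ 1 / sin \<psi>)\<^sup>2 + (e $ 2 / sin \<psi>)\<^sup>2 = 1"
      by (simp add: power_divide flip: add_divide_distrib)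
    then obtain \<alpha> where "e $ 1 / sin \<psi> = cos \<alpha>" "e $ 2 / sin \<psi> = sin \<alpha>"
      by (metis sincos_total_2pi)
    with False that[of \<alpha>] show ?thesis by (simp add: field_simps)
  qed
  with c that[of \<psi> \<alpha>] show ?thesis
    by (simp add: spherical_coords_def vec_eq_iff forall_3)
qed

section \<open>Rotational invariance of surface integrals\<close>

text \<open>Turning the axis within a meridian plane is generated, up to sign, by the Killing field
  \<open>cos (\<phi> - \<alpha>) \<partial>\<^sub>\<theta> - cot \<theta> sin (\<phi> - \<alpha>) \<partial>\<^sub>\<phi>\<close> on the sphere, whose flow preserves area.
  In coordinates: with \<open>u\<close> the argument of \<open>f\<close>, the \<open>\<psi>\<close>-derivative of \<open>sin \<theta> f(u)\<close> equals
  \<open>\<partial>\<^sub>\<phi> (cos \<theta> sin (\<phi> - \<alpha>) f(u)) - \<partial>\<^sub>\<theta> (sin \<theta> cos (\<phi> - \<alpha>) f(u))\<close>. The first term integrates to zero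
  by periodicity in \<open>\<phi>\<close>, the second because \<open>sin \<theta>\<close> vanishes at both poles.\<close>

lemma integral_zonal_function_rotate:
  fixes f f' :: "real \<Rightarrow> 'c::banach" and \<alpha> :: real
  assumes f: "\<And>x. (f has_vector_derivative f' x) (at x)"
    and cf': "continuous_on UNIV f'"
  defines "J \<equiv> \<lambda>\<psi>. integral (cbox (0, 0) (pi, 2 * pi))
       (\<lambda>(\<theta>, \<phi>). sin \<theta> *\<^sub>R f (sin \<psi> * (sin \<theta> * cos (\<phi> - \<alpha>)) + cos \<psi> * cos \<theta>))"
  shows "J \<psi> = J 0"
proof -
  define u where "u = (\<lambda>\<psi> \<theta> \<phi>. sin \<psi> * (sin \<theta> * cos (\<phi> - \<alpha>)) + cos \<psi> * cos \<theta>)"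
  define g where "g = (\<lambda>\<psi> (\<theta>, \<phi>). (sin \<theta> * (cos \<psi> * (sin \<theta> * cos (\<phi> - \<alpha>)) - sin \<psi> * cos \<theta>)) *\<^sub>R f' (u \<psi> \<theta> \<phi>))"
  have cf: "continuous_on UNIV f"
    using f by (meson continuous_at_imp_continuous_on has_vector_derivative_continuous)
  note cont [continuous_intros] = continuous_on_compose2[OF cf _ subset_UNIV] continuous_on_compose2[OF cf' _ subset_UNIV]
  have fd [derivative_intros]: "((\<lambda>x. f (h x)) has_vector_derivative h' *\<^sub>R f' (h x)) (at x within S)"
    if "(h has_field_derivative h') (at x within S)" for h h' x S
    using vector_diff_chain_within[of h h' x S f "f' (h x)"] that f
    by (simp add: o_def has_real_derivative_iff_has_vector_derivative has_vector_derivative_at_within)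
  have dJ: "(J has_vector_derivative integral (cbox (0, 0) (pi, 2 * pi)) (g \<psi>)) (at \<psi> within UNIV)" for \<psi>
    unfolding J_def
  proof (rule leibniz_rule_vector_derivative)
    show "continuous_on (UNIV \<times> cbox (0, 0) (pi, 2 * pi)) (\<lambda>(x, y). g x y)"
      unfolding g_def u_def split_beta by (intro continuous_intros)
    show "(\<lambda>(\<theta>, \<phi>). sin \<theta> *\<^sub>R f (sin \<psi> * (sin \<theta> * cos (\<phi> - \<alpha>)) + cos \<psi> * cos \<theta>)) integrable_on
         cbox (0, 0) (pi, 2 * pi)" for \<psi>
      unfolding split_beta by (intro integrable_continuous continuous_intros)
  next
    fix \<psi> :: real and q :: "real \<times> real"
    show "((\<lambda>\<psi>. case q of (\<theta>, \<phi>) \<Rightarrow> sin \<theta> *\<^sub>R f (sin \<psi> * (sin \<theta> * cos (\<phi> - \<alpha>)) + cos \<psi> * cos \<theta>))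
       has_vector_derivative g \<psi> q) (at \<psi> within UNIV)"
      unfolding g_def u_def split_beta
      by (rule derivative_eq_intros refl | simp add: algebra_simps)+
  qed auto
  have "integral (cbox (0, 0) (pi, 2 * pi)) (g \<psi>) = 0" for \<psi>
  proof -
    \<comment> \<open>\<open>A = \<partial>\<^sub>\<theta> (sin \<theta> cos (\<phi> - \<alpha>) f(u))\<close> and \<open>B = \<partial>\<^sub>\<phi> (cos \<theta> sin (\<phi> - \<alpha>) f(u))\<close>.\<close>
    define A where "A = (\<lambda>\<theta> \<phi>. (cos \<theta> * cos (\<phi> - \<alpha>)) *\<^sub>R f (u \<psi> \<theta> \<phi>) +
      (sin \<theta> * cos (\<phi> - \<alpha>) * (sin \<psi> * (cos \<theta> * cos (\<phi> - \<alpha>)) - cos \<psi> * sin \<theta>)) *\<^sub>R f' (u \<psi> \<theta> \<phi>))"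
    define B where "B = (\<lambda>\<theta> \<phi>. (cos \<theta> * cos (\<phi> - \<alpha>)) *\<^sub>R f (u \<psi> \<theta> \<phi>) +
      (cos \<theta> * sin (\<phi> - \<alpha>) * (- sin \<psi> * (sin \<theta> * sin (\<phi> - \<alpha>)))) *\<^sub>R f' (u \<psi> \<theta> \<phi>))"
    have contA: "continuous_on S (\<lambda>(\<theta>, \<phi>). A \<theta> \<phi>)" and contB: "continuous_on S (\<lambda>(\<theta>, \<phi>). B \<theta> \<phi>)" for S
      unfolding A_def B_def u_def split_beta by (intro continuous_intros)+
    have "((\<lambda>\<theta>. A \<theta> \<phi>) has_integral (sin pi * cos (\<phi> - \<alpha>)) *\<^sub>R f (u \<psi> pi \<phi>) - (sin 0 * cos (\<phi> - \<alpha>)) *\<^sub>R f (u \<psi> 0 \<phi>)) {0..pi}" for \<phi>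
      unfolding A_def u_def
      by (intro fundamental_theorem_of_calculus) (rule derivative_eq_intros refl | simp add: algebra_simps)+
    then have A0: "integral (cbox 0 pi) (\<lambda>\<theta>. A \<theta> \<phi>) = 0" for \<phi>
      using integral_unique by fastforce
    have per: "cos (2 * pi - \<alpha>) = cos \<alpha>" "sin (2 * pi - \<alpha>) = - sin \<alpha>"
      by (simp_all add: cos_diff sin_diff)
    have "((\<lambda>\<phi>. B \<theta> \<phi>) has_integral (cos \<theta> * sin (2 * pi - \<alpha>)) *\<^sub>R f (u \<psi> \<theta> (2 * pi)) - (cos \<theta> * sin (0 - \<alpha>)) *\<^sub>R f (u \<psi> \<theta> 0)) {0..2*pi}" for \<theta>
      unfolding B_def u_def
      by (intro fundamental_theorem_of_calculus) (rule derivative_eq_intros refl | simp add: algebra_simps)+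
    then have B0: "integral (cbox 0 (2*pi)) (\<lambda>\<phi>. B \<theta> \<phi>) = 0" for \<theta>
      using integral_unique per by (fastforce simp: u_def)
    have AB: "g \<psi> = (\<lambda>q. (\<lambda>(\<theta>, \<phi>). B \<theta> \<phi>) q - (\<lambda>(\<theta>, \<phi>). A \<theta> \<phi>) q)"
    proof (rule ext, clarify)
      fix \<theta> \<phi>
      have e: "sin \<theta> * (cos \<psi> * (sin \<theta> * cos (\<phi> - \<alpha>)) - sin \<psi> * cos \<theta>)
         = cos \<theta> * sin (\<phi> - \<alpha>) * (- sin \<psi> * (sin \<theta> * sin (\<phi> - \<alpha>)))
         - sin \<theta> * cos (\<phi> - \<alpha>) * (sin \<psi> * (cos \<theta> * cos (\<phi> - \<alpha>)) - cos \<psi> * sin \<theta>)"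
        using sin_cos_squared_add[of "\<phi> - \<alpha>"] by algebra
      show "g \<psi> (\<theta>, \<phi>) = B \<theta> \<phi> - A \<theta> \<phi>"
        unfolding g_def A_def B_def prod.case e by (simp add: scaleR_diff_left)
    qed
    have "integral (cbox (0, 0) (pi, 2 * pi)) (\<lambda>(\<theta>, \<phi>). A \<theta> \<phi>) = 0"
      using integral_prod_continuous[OF contA] integral_swap_continuous[OF contA] A0 by simp
    moreover have "integral (cbox (0, 0) (pi, 2 * pi)) (\<lambda>(\<theta>, \<phi>). B \<theta> \<phi>) = 0"
      using integral_prod_continuous[OF contB] B0 by simp
    ultimately show ?thesis
      unfolding AB
      by (subst Henstock_Kurzweil_Integration.integral_diff)
         (auto intro!: integrable_continuous contA contB)
  qed
  with dJ have "(J has_vector_derivative 0) (at \<psi> within UNIV)" for \<psi> by metis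
  then have "(J has_derivative (\<lambda>h. 0)) (at \<psi>)" for \<psi>
    unfolding has_vector_derivative_def by simp
  then have "\<exists>k. \<forall>x\<in>UNIV. J x = k"
    by (intro has_derivative_zero_constant) auto
  then show ?thesis by auto
qed

section \<open>The uniform distribution on the sphere\<close>

text \<open>The area density of the unit sphere in colatitude and longitude, normalised to total mass one.
  The box is closed in the longitude, unlike the domain of the sphere chart: this changes the
  measure by a null set only and makes continuous integrands integrable by compactness.\<close>

definition angle_density :: "real \<times> real \<Rightarrow> real" where
  "angle_density q = indicator (cbox (0, 0) (pi, 2 * pi)) q * sin (fst q) / (4 * pi)"

definition angle_measure :: "(real \<times> real) measure" where
  "angle_measure = density lborel (\<lambda>q. ennreal (angle_density q))"

lemma angle_density_nonneg: "0 \<le> angle_density q"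
  by (auto simp: angle_density_def cbox_Pair_eq mem_Times_iff sin_ge_zero split: split_indicator)

lemma angle_density_measurable [measurable]: "angle_density \<in> borel_measurable borel"
  unfolding angle_density_def
  by (intro borel_measurable_divide borel_measurable_times borel_measurable_indicator
      borel_measurable_continuous_onI continuous_intros) auto

lemma cos_fst_measurable [measurable]:
  "(\<lambda>q :: real \<times> real. cos (fst q)) \<in> borel_measurable borel"
  by (intro borel_measurable_continuous_onI continuous_intros)

lemma sets_angle_measure [simp, measurable_cong]: "sets angle_measure = sets borel"
  by (simp add: angle_measure_def)

lemma space_angle_measure [simp]: "space angle_measure = UNIV"
  by (simp add: angle_measure_def)

text \<open>Archimedes: the height \<open>cos \<theta>\<close> of a uniform point is uniform on \<open>[-1, 1]\<close>, since
  \<open>sin \<theta> d\<theta>\<close> is the differential of \<open>- cos \<theta>\<close>.\<close>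

lemma emeasure_angle_measure_polar_cap:
  assumes "-1 \<le> t" "t \<le> 1"
  shows "emeasure angle_measure {q. cos (fst q) \<le> t} = ennreal ((1 + t) / 2)"
proof -
  have b: "0 \<le> arccos t" "arccos t \<le> pi"
    using assms by (auto simp: arccos_lbound arccos_ubound)
  have iff: "cos \<theta> \<le> t \<longleftrightarrow> arccos t \<le> \<theta>" if "0 \<le> \<theta>" "\<theta> \<le> pi" for \<theta>
    using assms that b cos_mono_le_eq[of \<theta> "arccos t"] by (simp add: cos_arccos)
  have "emeasure angle_measure {q. cos (fst q) \<le> t} =
      (\<integral>\<^sup>+q. ennreal (angle_density q) * indicator {q. cos (fst q) \<le> t} q \<partial>lborel)"
    unfolding angle_measure_def by (subst emeasure_density) auto
  also have "\<dots> = (\<integral>\<^sup>+q. ennreal (angle_density q) * indicator {q. cos (fst q) \<le> t} q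
      \<partial>(lborel \<Otimes>\<^sub>M lborel))"
    by (simp add: lborel_prod)
  also have "\<dots> = (\<integral>\<^sup>+\<theta>. (\<integral>\<^sup>+\<phi>. ennreal (angle_density (\<theta>, \<phi>)) *
      indicator {q. cos (fst q) \<le> t} (\<theta>, \<phi>) \<partial>lborel) \<partial>lborel)"
    by (subst lborel.nn_integral_fst[symmetric]) (auto simp: lborel_prod)
  also have "\<dots> = (\<integral>\<^sup>+\<theta>. (\<integral>\<^sup>+\<phi>. ennreal (sin \<theta> / (4 * pi)) * indicator {arccos t..pi} \<theta>
      * indicator {0..2 * pi} \<phi> \<partial>lborel) \<partial>lborel)"
    using b by (intro nn_integral_cong)
      (auto simp: angle_density_def iff cbox_Pair_eq split: split_indicator)
  also have "\<dots> = (\<integral>\<^sup>+\<theta>. ennreal (sin \<theta> / 2) * indicator {arccos t..pi} \<theta> \<partial>lborel)"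
    using b by (intro nn_integral_cong)
      (auto simp: nn_integral_cmult sin_ge_zero ennreal_mult[symmetric] split: split_indicator)
  also have "\<dots> = ennreal (- cos pi / 2 - (- cos (arccos t) / 2))"
    using b by (intro nn_integral_FTC_Icc)
      (auto intro!: derivative_eq_intros sin_ge_zero simp: field_simps)
  finally show ?thesis
    using assms by (simp add: cos_arccos add_divide_distrib)
qed

lemma prob_space_angle_measure: "prob_space angle_measure"
proof
  have "{q :: real \<times> real. cos (fst q) \<le> 1} = UNIV" by auto
  then show "emeasure angle_measure (space angle_measure) = 1"
    using emeasure_angle_measure_polar_cap[of 1] by simp
qed

interpretation angle_measure: prob_space angle_measure
  by (rule prob_space_angle_measure)

lemma lebesgue_integral_angle_measure:
  fixes g :: "real \<times> real \<Rightarrow> complex"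
  assumes "continuous_on UNIV g"
  shows "(\<integral>q. g q \<partial>angle_measure) =
    integral (cbox (0, 0) (pi, 2 * pi)) (\<lambda>q. sin (fst q) *\<^sub>R g q) / (4 * pi)"
proof -
  have [measurable]: "g \<in> borel_measurable borel"
    using assms by (rule borel_measurable_continuous_onI)
  have int: "set_integrable lborel (cbox (0, 0) (pi, 2 * pi)) (\<lambda>q. sin (fst q) *\<^sub>R g q)"
    unfolding set_integrable_def
    by (intro borel_integrable_compact compact_cbox continuous_intros
        continuous_on_subset[OF assms]) auto
  have "(\<integral>q. g q \<partial>angle_measure) = (\<integral>q. angle_density q *\<^sub>R g q \<partial>lborel)"
    unfolding angle_measure_def by (intro integral_density) (auto simp: angle_density_nonneg)
  also have "\<dots> = (LINT q:cbox (0, 0) (pi, 2 * pi)|lborel. sin (fst q) *\<^sub>R g q) / (4 * pi)"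
    unfolding set_lebesgue_integral_def integral_divide_zero[symmetric]
    by (intro Bochner_Integration.integral_cong)
       (auto simp: angle_density_def scaleR_conv_of_real)
  finally show ?thesis
    by (simp add: set_borel_integral_eq_integral[OF int])
qed

text \<open>All coordinates of a uniform point, in whatever direction, have the same law: their
  characteristic functions agree, because an integral of \<open>f(e \<bullet> n)\<close> over the sphere can be rotated
  until \<open>e\<close> points to the pole.\<close>

lemma distr_inner_angle_measure:
  assumes "norm e = 1"
  shows "distr angle_measure borel (\<lambda>q. e \<bullet> spherical_coords 0 1 q) =
         distr angle_measure borel (\<lambda>q. cos (fst q))"
proof (rule Levy_uniqueness)
  show "real_distribution (distr angle_measure borel (\<lambda>q. e \<bullet> spherical_coords 0 1 q))"
    by (intro angle_measure.real_distribution_distr) measurable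
  show "real_distribution (distr angle_measure borel (\<lambda>q. cos (fst q)))"
    by (intro angle_measure.real_distribution_distr) auto
  obtain \<psi> \<alpha> where e: "e = spherical_coords 0 1 (\<psi>, \<alpha>)"
    using unit_vector_spherical[OF assms] .
  have e_inner: "e \<bullet> spherical_coords 0 1 q =
      sin \<psi> * (sin (fst q) * cos (snd q - \<alpha>)) + cos \<psi> * cos (fst q)" for q
    using inner_spherical_coords[of \<psi> \<alpha> "fst q" "snd q"] by (simp add: e)
  show "char (distr angle_measure borel (\<lambda>q. e \<bullet> spherical_coords 0 1 q)) =
        char (distr angle_measure borel (\<lambda>q. cos (fst q)))"
  proof
    fix s :: real
    have d: "((\<lambda>x. iexp (s * x)) has_vector_derivative s *\<^sub>R (\<i> * iexp (s * x))) (at x)" for x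
      by (auto intro!: derivative_eq_intros simp: has_vector_derivative_complex_iff Re_exp Im_exp)
    have "char (distr angle_measure borel (\<lambda>q. e \<bullet> spherical_coords 0 1 q)) s =
        (CLINT q|angle_measure. iexp (s * (e \<bullet> spherical_coords 0 1 q)))"
      by (simp add: char_def integral_distr)
    also have "\<dots> = integral (cbox (0, 0) (pi, 2 * pi))
        (\<lambda>q. sin (fst q) *\<^sub>R iexp (s * (e \<bullet> spherical_coords 0 1 q))) / (4 * pi)"
      by (intro lebesgue_integral_angle_measure continuous_intros continuous_on_spherical_coords)
    also have "integral (cbox (0, 0) (pi, 2 * pi))
        (\<lambda>q. sin (fst q) *\<^sub>R iexp (s * (e \<bullet> spherical_coords 0 1 q))) =
        integral (cbox (0, 0) (pi, 2 * pi)) (\<lambda>q. sin (fst q) *\<^sub>R iexp (s * cos (fst q)))"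
      using integral_zonal_function_rotate[of "\<lambda>x. iexp (s * x)" "\<lambda>x. s *\<^sub>R (\<i> * iexp (s * x))" \<psi> \<alpha>, OF d]
      by (simp add: e_inner split_beta' continuous_intros)
    also have "\<dots> / (4 * pi) = (CLINT q|angle_measure. iexp (s * cos (fst q)))"
      by (intro lebesgue_integral_angle_measure[symmetric] continuous_intros)
    also have "\<dots> = char (distr angle_measure borel (\<lambda>q. cos (fst q))) s"
      by (simp add: char_def integral_distr)
    finally show "char (distr angle_measure borel (\<lambda>q. e \<bullet> spherical_coords 0 1 q)) s =
        char (distr angle_measure borel (\<lambda>q. cos (fst q))) s" .
  qed
qed

lemma AE_lborel_snd_neq: "AE q in (lborel :: (real \<times> real) measure). snd q \<noteq> a"
proof -
  have "negligible {q :: real \<times> real. q \<bullet> (0, 1) = a}"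
    by (rule negligible_standard_hyperplane) (simp add: Basis_prod_def)
  moreover have "{q :: real \<times> real. q \<bullet> (0, 1) = a} \<in> sets borel"
    by (intro borel_closed closed_Collect_eq continuous_intros)
  ultimately have "{q :: real \<times> real. q \<bullet> (0, 1) = a} \<in> null_sets lborel"
    by (simp add: negligible_iff_null_sets null_sets_completion_iff)
  then show ?thesis
    by (rule AE_I') auto
qed

lemma emeasure_sphere_area_measure:
  assumes [measurable]: "A \<in> sets borel"
  shows "emeasure (sphere_area_measure c R) A =
    ennreal (4 * pi * R\<^sup>2) * emeasure (distr angle_measure borel (spherical_coords c R)) A"
proof -
  let ?D = "{0..pi} \<times> {0..<2 * pi}" and ?S = "spherical_coords c R"
  have [measurable]: "?S -` A \<in> sets borel"
    using measurable_sets[OF spherical_coords_measurable assms] by simp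
  have el: "surface_element ?S = (\<lambda>q. R\<^sup>2 * \<bar>sin (fst q)\<bar>)"
    using surface_element_spherical_coords by auto
  have [measurable]: "surface_element ?S \<in> borel_measurable borel"
    unfolding el by (intro borel_measurable_continuous_onI continuous_intros)
  have [measurable]: "?D \<in> sets borel"
    by (simp add: borel_prod[symmetric])
  have "emeasure (sphere_area_measure c R) A =
      (\<integral>\<^sup>+q. ennreal (surface_element ?S q) * indicator ?D q * indicator (?S -` A) q \<partial>lborel)"
    unfolding sphere_area_measure_def surface_area_measure_def
    by (simp add: emeasure_distr emeasure_density)
  also have "\<dots> = (\<integral>\<^sup>+q. ennreal (4 * pi * R\<^sup>2) *
      (ennreal (angle_density q) * indicator (?S -` A) q) \<partial>lborel)"
  proof (rule nn_integral_cong_AE, use AE_lborel_snd_neq[of "2 * pi"] in eventually_elim)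
    fix q :: "real \<times> real"
    assume "snd q \<noteq> 2 * pi"
    then show "ennreal (surface_element ?S q) * indicator ?D q * indicator (?S -` A) q =
      ennreal (4 * pi * R\<^sup>2) * (ennreal (angle_density q) * indicator (?S -` A) q)"
      by (auto simp: el angle_density_def cbox_Pair_eq mem_Times_iff sin_ge_zero ennreal_mult[symmetric]
          split: split_indicator)
  qed
  also have "\<dots> = ennreal (4 * pi * R\<^sup>2) * emeasure angle_measure (?S -` A)"
    by (simp add: nn_integral_cmult angle_measure_def emeasure_density)
  finally show ?thesis
    by (simp add: emeasure_distr)
qed

lemma uniform_on_sphere_eq_distr:
  assumes "R > 0"
  shows "uniform_on_sphere c R = distr angle_measure borel (spherical_coords c R)"
proof (rule measure_eqI)
  have sets_area: "sets (sphere_area_measure c R) = sets borel"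
    by (simp add: sphere_area_measure_def surface_area_measure_def)
  show "sets (uniform_on_sphere c R) = sets (distr angle_measure borel (spherical_coords c R))"
    by (simp add: uniform_on_sphere_def sets_area)
  fix A assume "A \<in> sets (uniform_on_sphere c R)"
  then have [measurable]: "A \<in> sets borel"
    by (simp add: uniform_on_sphere_def sets_area)
  have [measurable]: "sphere c R \<in> sets borel" by simp
  have pre: "spherical_coords c R -` (sphere c R \<inter> B) = spherical_coords c R -` B" for B
    using assms by (auto simp: dist_spherical_coords)
  have "emeasure (uniform_on_sphere c R) A =
      ennreal (4 * pi * R\<^sup>2) * emeasure angle_measure (spherical_coords c R -` A) /
      (ennreal (4 * pi * R\<^sup>2) * emeasure angle_measure (spherical_coords c R -` UNIV))"
    using pre[of A] pre[of UNIV]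
    by (simp add: uniform_on_sphere_def sets_area emeasure_sphere_area_measure emeasure_distr)
  also have "emeasure angle_measure (spherical_coords c R -` UNIV) = 1"
    using angle_measure.emeasure_space_1 by simp
  finally show "emeasure (uniform_on_sphere c R) A =
      emeasure (distr angle_measure borel (spherical_coords c R)) A"
    using assms
    by (simp add: emeasure_distr mult.commute ennreal_mult_divide_eq)
qed

lemma prob_cap:
  assumes "norm e = 1" "-1 \<le> t" "t \<le> 1"
  shows "measure angle_measure {q. e \<bullet> spherical_coords 0 1 q \<le> t} = (1 + t) / 2"
proof -
  have "emeasure (distr angle_measure borel (\<lambda>q. e \<bullet> spherical_coords 0 1 q)) {..t} =
     emeasure (distr angle_measure borel (\<lambda>q. cos (fst q))) {..t}"
    by (simp add: distr_inner_angle_measure[OF assms(1)])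
  then have "emeasure angle_measure {q. e \<bullet> spherical_coords 0 1 q \<le> t} = ennreal ((1 + t) / 2)"
    using emeasure_angle_measure_polar_cap[OF assms(2,3)]
    by (simp add: emeasure_distr vimage_def)
  then show ?thesis
    using assms by (simp add: measure_def)
qed

text \<open>With \<open>e\<close> the unit vector from \<open>p\<close> towards the centre and \<open>n\<close> the direction of a point of
  the sphere, the law of cosines gives the squared distance to \<open>p\<close> as
  \<open>r\<^sup>2 + R\<^sup>2 + 2 r R (e \<bullet> n)\<close>. A ball about \<open>p\<close> therefore cuts out the cap \<open>e \<bullet> n \<le> t\<close>, where \<open>t\<close>
  solves this expression for the squared radius \<open>d\<^sup>2\<close>.\<close>

lemma prob_uniform_on_sphere_cball:
  assumes "0 < r" "r < R" "dist c p = r" "R - r \<le> d" "d \<le> R + r"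
  shows "measure (uniform_on_sphere c R) (cball p d) = (d\<^sup>2 - (R - r)\<^sup>2) / (4 * r * R)"
proof -
  define e where "e = (c - p) /\<^sub>R r"
  define t where "t = (d\<^sup>2 - r\<^sup>2 - R\<^sup>2) / (2 * r * R)"
  have R: "0 < R" and d: "0 \<le> d" using assms by auto
  have e: "norm e = 1" "p = c - r *\<^sub>R e"
    using assms by (auto simp: e_def dist_norm)
  have "(R - r)\<^sup>2 \<le> d\<^sup>2" "d\<^sup>2 \<le> (R + r)\<^sup>2"
    using assms by (auto intro!: power_mono)
  then have t: "-1 \<le> t" "t \<le> 1"
    using assms R by (auto simp: t_def field_simps power2_eq_square)
  have "dist p (spherical_coords c R q) \<le> d \<longleftrightarrow> e \<bullet> spherical_coords 0 1 q \<le> t" for q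
  proof -
    let ?n = "spherical_coords 0 1 q"
    have n: "norm ?n = 1"
      using dist_spherical_coords[of 0 1 q] by simp
    have "p - spherical_coords c R q = - (r *\<^sub>R e + R *\<^sub>R ?n)"
      by (simp add: e(2) spherical_coords_def split_beta)
    then have "(dist p (spherical_coords c R q))\<^sup>2 = (norm (r *\<^sub>R e + R *\<^sub>R ?n))\<^sup>2"
      by (simp only: dist_norm norm_minus_cancel)
    also have "\<dots> = r\<^sup>2 + R\<^sup>2 + 2 * r * R * (e \<bullet> ?n)"
      using e(1) n unfolding power2_norm_eq_inner
      by (simp add: inner_add_left inner_add_right inner_commute norm_eq_1 power2_eq_square)
    finally have "dist p (spherical_coords c R q) \<le> d \<longleftrightarrow> r\<^sup>2 + R\<^sup>2 + 2 * r * R * (e \<bullet> ?n) \<le> d\<^sup>2"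
      using d by (metis abs_le_square_iff abs_of_nonneg zero_le_dist)
    also have "\<dots> \<longleftrightarrow> e \<bullet> ?n \<le> t"
      using assms(1) R by (simp add: t_def field_simps)
    finally show ?thesis .
  qed
  then have "measure (uniform_on_sphere c R) (cball p d) = (1 + t) / 2"
    using prob_cap[OF e(1) t]
    by (simp add: uniform_on_sphere_eq_distr[OF R] measure_distr vimage_def mem_cball)
  also have "\<dots> = (d\<^sup>2 - (R - r)\<^sup>2) / (4 * r * R)"
    using assms(1) R by (simp add: t_def field_simps power2_eq_square)
  finally show ?thesis .
qed

text \<open>At \<open>R - r\<close> and \<open>R + r\<close> the formula takes the values 0 and 1, which persist beyond by monotonicity:
  the ball then misses the sphere up to a null set, or contains it.\<close>

lemma prob_uniform_on_sphere_cball_cases: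
  assumes r: "0 < r" "r < R" and p: "dist c p = r"
  shows "measure (uniform_on_sphere c R) (cball p d) =
    (if d \<le> R - r then 0
     else if d < R + r then (d\<^sup>2 - (R - r)\<^sup>2) / (4 * r * R)
     else 1)"
proof -
  have R: "0 < R" using r by simp
  interpret U: prob_space "uniform_on_sphere c R"
    unfolding uniform_on_sphere_eq_distr[OF R]
    by (rule angle_measure.prob_space_distr) simp
  have [simp]: "sets (uniform_on_sphere c R) = sets borel"
    by (simp add: uniform_on_sphere_eq_distr[OF R])
  consider "d \<le> R - r" | "R - r < d" "d < R + r" | "R + r \<le> d" by linarith
  then show ?thesis
  proof cases
    case 1
    have "U.prob (cball p d) \<le> U.prob (cball p (R - r))"
      using 1 by (intro U.finite_measure_mono subset_cball) auto
    also have "\<dots> = 0"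
      using r p by (subst prob_uniform_on_sphere_cball[of r]) auto
    finally show ?thesis using 1 by (simp add: measure_le_0_iff)
  next
    case 2
    then show ?thesis using prob_uniform_on_sphere_cball[OF r p, of d] by simp
  next
    case 3
    have "(R + r)\<^sup>2 - (R - r)\<^sup>2 = 4 * r * R"
      by (simp add: power2_eq_square algebra_simps)
    then have "1 = U.prob (cball p (R + r))"
      using r p by (subst prob_uniform_on_sphere_cball[of r]) auto
    also have "\<dots> \<le> U.prob (cball p d)"
      using 3 by (intro U.finite_measure_mono subset_cball) auto
    finally show ?thesis
      using 3 r U.prob_le_1[of "cball p d"] by simp
  qed
qed

section \<open>Hitting probability of independent points\<close>

lemma (in prob_space) prob_iid_hits:
  fixes X :: "nat \<Rightarrow> 'a \<Rightarrow> 'b :: topological_space"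
  assumes ind: "indep_vars (\<lambda>_. borel) X {..<n}" and n: "n \<ge> 1"
    and D: "\<And>i. i < n \<Longrightarrow> distr M borel (X i) = D"
    and A: "A \<in> sets borel"
  shows "prob {\<omega> \<in> space M. \<exists>i<n. X i \<omega> \<in> A} = 1 - (1 - measure D A) ^ n"
proof -
  have X: "X i \<in> borel_measurable M" if "i < n" for i
    using ind that by (auto simp: indep_vars_def)
  let ?E = "{\<omega> \<in> space M. \<exists>i<n. X i \<omega> \<in> A}"
  have "?E = (\<Union>i\<in>{..<n}. X i -` A \<inter> space M)" by auto
  then have E: "?E \<in> events" using A X by (auto simp del: UN_simps intro!: sets.finite_UN measurable_sets)
  have one: "prob (X i -` (- A) \<inter> space M) = 1 - measure D A" if "i < n" for i
  proof -
    interpret Di: prob_space "distr M borel (X i)"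
      by (rule prob_space_distr) (simp add: X that)
    have "prob (X i -` (- A) \<inter> space M) = measure (distr M borel (X i)) (space (distr M borel (X i)) - A)"
      using A X[OF that] by (subst measure_distr) (auto simp: Compl_eq_Diff_UNIV)
    also have "\<dots> = 1 - measure (distr M borel (X i)) A"
      using A by (intro Di.prob_compl) simp
    finally show ?thesis using D[OF that] by simp
  qed
  have ne: "{..<n} \<noteq> {}" using n by (metis lessThan_empty_iff not_one_le_zero)
  have "1 - prob ?E = prob (space M - ?E)"
    by (rule prob_compl[OF E, symmetric])
  also have "space M - ?E = (\<Inter>i\<in>{..<n}. X i -` (- A) \<inter> space M)"
    using ne by blast
  also have "prob \<dots> = (\<Prod>i<n. prob (X i -` (- A) \<inter> space M))"
    using A ne by (intro indep_varsD_finite[OF ind]) auto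
  also have "\<dots> = (1 - measure D A) ^ n"
    by (simp add: one)
  finally show ?thesis by simp
qed

theorem lemma2:
  fixes M :: "'w measure"
    and sat :: "nat \<Rightarrow> 'w \<Rightarrow> real^3"
    and relay :: "'w \<Rightarrow> nat"
    and c p :: "real^3"
    and N\<^sub>s :: nat
    and R\<^sub>e R\<^sub>s d\<^sub>0 :: real
  assumes "prob_space M"
    and "N\<^sub>s \<ge> 1"
    and "0 < R\<^sub>e" and "R\<^sub>e < R\<^sub>s"
    and "dist c p = R\<^sub>e"
    and "prob_space.indep_vars M (\<lambda>_. borel) sat {..<N\<^sub>s}"
    and "\<And>i. i < N\<^sub>s \<Longrightarrow> distr M borel (sat i) = uniform_on_sphere c R\<^sub>s"
    and "\<And>\<omega>. \<omega> \<in> space M \<Longrightarrow>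
           is_arg_min (\<lambda>i. dist p (sat i \<omega>)) (\<lambda>i. i < N\<^sub>s) (relay \<omega>)"
  shows "cdf (distr M borel (\<lambda>\<omega>. dist p (sat (relay \<omega>) \<omega>))) d\<^sub>0 =
           (if d\<^sub>0 \<le> R\<^sub>s - R\<^sub>e then 0
            else if d\<^sub>0 < R\<^sub>s + R\<^sub>e
              then 1 - (1 - (d\<^sub>0\<^sup>2 - (R\<^sub>s - R\<^sub>e)\<^sup>2) / (4 * R\<^sub>e * R\<^sub>s)) ^ N\<^sub>s
            else 1)"
proof -
  interpret prob_space M by fact
  let ?d = "\<lambda>\<omega>. dist p (sat (relay \<omega>) \<omega>)"
  have sat: "sat i \<in> borel_measurable M" if "i < N\<^sub>s" for i
    using assms(6) that by (auto simp: indep_vars_def)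
  \<comment> \<open>This removes the relay index: the sublevel sets of the distance are the events that some
    satellite lies in a ball about the receiver, which also makes the distance measurable.\<close>
  have le_iff: "?d \<omega> \<le> a \<longleftrightarrow> (\<exists>i<N\<^sub>s. sat i \<omega> \<in> cball p a)" if "\<omega> \<in> space M" for \<omega> a
    using assms(8)[OF that] by (force simp: is_arg_min_linorder)
  have ev: "{\<omega> \<in> space M. ?d \<omega> \<le> a} = {\<omega> \<in> space M. \<exists>i<N\<^sub>s. sat i \<omega> \<in> cball p a}" for a
    using le_iff by blast
  have "{\<omega> \<in> space M. ?d \<omega> \<le> a} \<in> events" for a
  proof -
    have "{\<omega> \<in> space M. ?d \<omega> \<le> a} = (\<Union>i\<in>{..<N\<^sub>s}. sat i -` cball p a \<inter> space M)"
      unfolding ev by auto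
    then show ?thesis using sat by (auto simp del: UN_simps intro!: sets.finite_UN measurable_sets)
  qed
  then have meas: "?d \<in> borel_measurable M"
    by (simp add: borel_measurable_iff_le)
  have "cdf (distr M borel ?d) d\<^sub>0 = prob {\<omega> \<in> space M. ?d \<omega> \<le> d\<^sub>0}"
    using meas by (auto simp: cdf_def measure_distr intro!: arg_cong[where f = prob])
  also have "\<dots> = 1 - (1 - measure (uniform_on_sphere c R\<^sub>s) (cball p d\<^sub>0)) ^ N\<^sub>s"
    unfolding ev by (intro prob_iid_hits assms borel_closed closed_cball)
  finally show ?thesis
    using assms(2) by (simp add: prob_uniform_on_sphere_cball_cases[OF assms(3,4,5)])
qed

end
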